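(* Let $\alpha,\beta\in\mathbb{K}^*$ be roots of unity with $\alpha\beta\neq1$, and let $\underline{\mu}=(\mu_1,\mu_2)\in(\mathbb{K}^* )^2$. Then the module $\mathscr{V}_3(\underline{\mu})$ is a simple $M_2(\alpha,\beta)$-module of dimension $\operatorname{ord}(\alpha\beta)\operatorname{ord}(\alpha\beta^{-1})$ over $\mathbb{K}$.
   Context: $\mathbb{K}$ is an algebraically closed field of arbitrary characteristic and $\mathbb{K}^*=\mathbb{K}\setminus\{0\}$; all modules are right modules. For a root of unity $\xi\in\mathbb{K}^*$, $\operatorname{ord}(\xi)$ is its order in the group $\mathbb{K}^*$. For $\alpha,\beta\in\mathbb{K}^*$, the two-parameter quantum matrix algebra $M_2(\alpha,\beta)$ is the associative unital $\mathbb{K}$-algebra generated by $X_{11},X_{12},X_{21},X_{22}$ subject to the relations $X_{12}X_{11}=\alpha X_{11}X_{12}$, $X_{22}X_{21}=\alpha X_{21}X_{22}$, $X_{21}X_{11}=\beta X_{11}X_{21}$, $X_{22}X_{12}=\beta X_{12}X_{22}$, $X_{21}X_{12}=\beta\alpha^{-1}X_{12}X_{21}$, $X_{22}X_{11}-X_{11}X_{22}=(\beta-\alpha^{-1})X_{12}X_{21}$. Set $l_2:=\operatorname{ord}(\alpha\beta^{-1})$. $\mathscr{V}_3(\underline{\mu})$ is the $\mathbb{K}$-vector space with basis $\{e(a,b):0\le a\le\operatorname{ord}(\alpha\beta)-1,\ 0\le b\le l_2-1\}$ and $M_2(\alpha,\beta)$-action (which does define a module structure) $$e(a,b)X_{11}=\begin{cases}\mu_2\alpha^{-1}(\alpha^{-1}\beta)^b[(\alpha\beta)^a-1]e(a-1,b)&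 a\neq0\\ 0& a=0\end{cases}$$ $$e(a,b)X_{12}=\mu_1^{-1}\mu_2\beta^a(\alpha^{-1}\beta)^be(a,b\dotplus(-1)),\qquad e(a,b)X_{21}=\mu_1\alpha^ae(a,b\dotplus1),$$ $$e(a,b)X_{22}=\begin{cases}e(a+1,b)& a\neq\operatorname{ord}(\alpha\beta)-1\\ 0& a=\operatorname{ord}(\alpha\beta)-1\end{cases}$$ where $\dotplus$ is addition modulo $l_2$. *)

theory Defs
  imports "HOL-Algebra.Algebra" "HOL-Algebra.Algebraic_Closure_Type" "HOL-Library.Poly_Mapping"
begin

text \<open>
  The type \<^typ>\<open>'i \<Rightarrow>\<^sub>0 'k\<close> is the vector space over \<^typ>\<open>'k\<close> with basis the elements
  \<^term>\<open>Poly_Mapping.single i 1\<close>.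
\<close>

definition fscale :: "'k::field \<Rightarrow> ('i \<Rightarrow>\<^sub>0 'k) \<Rightarrow> ('i \<Rightarrow>\<^sub>0 'k)"
  where "fscale c v = Poly_Mapping.map ((*) c) v"

lemma lookup_fscale [simp]:
  "Poly_Mapping.lookup (fscale c v) i = c * Poly_Mapping.lookup v i"
  by (auto simp: fscale_def Poly_Mapping.map.rep_eq when_def)

lemma vector_space_fscale: "vector_space fscale"
  by unfold_locales (auto intro!: poly_mapping_eqI simp: lookup_add algebra_simps)

definition lin_ext :: "('i \<Rightarrow> ('j \<Rightarrow>\<^sub>0 'k)) \<Rightarrow> ('i \<Rightarrow>\<^sub>0 'k::field) \<Rightarrow> ('j \<Rightarrow>\<^sub>0 'k)"
  where "lin_ext f v = (\<Sum>i\<in>Poly_Mapping.keys v. fscale (Poly_Mapping.lookup v i) (f i))"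

lemma lin_ext_single [simp]: "lin_ext f (Poly_Mapping.single i 1) = f i"
  by (auto intro!: poly_mapping_eqI simp: lin_ext_def)

datatype 'x word = Word (letters: "'x list")

text \<open>
  The free monoid is written additively because the convolution product of
  \<^typ>\<open>'i \<Rightarrow>\<^sub>0 'k\<close> is defined for additive monoids of exponents.  With this instance,
  \<^typ>\<open>'x word \<Rightarrow>\<^sub>0 'k\<close> is the free associative unital algebra on \<^typ>\<open>'x\<close>.
\<close>

instantiation word :: (type) monoid_add
begin

definition zero_word :: "'a word"
  where "0 = Word []"

definition plus_word :: "'a word \<Rightarrow> 'a word \<Rightarrow> 'a word"
  where "u + w = Word (letters u @ letters w)"

instance
  by standard (simp_all add: zero_word_def plus_word_def)

end

definition free_gen :: "'x \<Rightarrow> ('x word \<Rightarrow>\<^sub>0 'k::field)"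
  where "free_gen x = Poly_Mapping.single (Word [x]) 1"

locale k_algebra = ring A for A (structure) +
  fixes scalar :: "'k::field \<Rightarrow> 'a"
  assumes scalar_hom: "scalar \<in> ring_hom ring_of_type_algebra A"
    and scalar_central: "x \<in> carrier A \<Longrightarrow> scalar c \<otimes> x = x \<otimes> scalar c"

text \<open>
  The underlying vector space of the module is the subspace \<open>V\<close> of the ambient vector
  space; \<open>act v x\<close> is the product of \<open>v\<close> with \<open>x\<close> on the right.
\<close>

locale right_module = k_algebra A scalar + vs: vector_space scale
  for A (structure) and scalar :: "'k::field \<Rightarrow> 'a"
    and scale :: "'k \<Rightarrow> 'v::ab_group_add \<Rightarrow> 'v" +
  fixes V :: "'v set" and act :: "'v \<Rightarrow> 'a \<Rightarrow> 'v"
  assumes subspace_V: "vs.subspace V"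
    and act_closed: "\<lbrakk>v \<in> V; x \<in> carrier A\<rbrakk> \<Longrightarrow> act v x \<in> V"
    and act_add_left:
      "\<lbrakk>v \<in> V; w \<in> V; x \<in> carrier A\<rbrakk> \<Longrightarrow> act (v + w) x = act v x + act w x"
    and act_add_right:
      "\<lbrakk>v \<in> V; x \<in> carrier A; y \<in> carrier A\<rbrakk> \<Longrightarrow> act v (x \<oplus> y) = act v x + act v y"
    and act_mult:
      "\<lbrakk>v \<in> V; x \<in> carrier A; y \<in> carrier A\<rbrakk> \<Longrightarrow> act v (x \<otimes> y) = act (act v x) y"
    and act_one: "v \<in> V \<Longrightarrow> act v \<one> = v"
    and act_scalar: "v \<in> V \<Longrightarrow> act v (scalar c) = scale c v"
begin

definition submodule :: "'v set \<Rightarrow> bool"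
  where "submodule W \<longleftrightarrow>
    W \<subseteq> V \<and> vs.subspace W \<and> (\<forall>w\<in>W. \<forall>x\<in>carrier A. act w x \<in> W)"

end

locale simple_right_module = right_module A scalar scale V act
  for A (structure) and scalar :: "'k::field \<Rightarrow> 'a"
    and scale :: "'k \<Rightarrow> 'v::ab_group_add \<Rightarrow> 'v"
    and V :: "'v set" and act :: "'v \<Rightarrow> 'a \<Rightarrow> 'v" +
  assumes nonzero: "V \<noteq> {0}"
    and simple: "submodule W \<Longrightarrow> W = {0} \<or> W = V"

datatype qgen = X11 | X12 | X21 | X22

definition M2_relations :: "'k \<Rightarrow> 'k \<Rightarrow> (qgen word \<Rightarrow>\<^sub>0 'k::field) set"
  where "M2_relations \<alpha> \<beta> =
   (let x11 = free_gen X11; x12 = free_gen X12; x21 = free_gen X21; x22 = free_gen X22 in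
     {x12 * x11 - fscale \<alpha> (x11 * x12),
      x22 * x21 - fscale \<alpha> (x21 * x22),
      x21 * x11 - fscale \<beta> (x11 * x21),
      x22 * x12 - fscale \<beta> (x12 * x22),
      x21 * x12 - fscale (\<beta> * inverse \<alpha>) (x12 * x21),
      x22 * x11 - x11 * x22 - fscale (\<beta> - inverse \<alpha>) (x12 * x21)})"

definition M2_ideal :: "'k \<Rightarrow> 'k \<Rightarrow> (qgen word \<Rightarrow>\<^sub>0 'k::field) set"
  where "M2_ideal \<alpha> \<beta> = genideal ring_of_type_algebra (M2_relations \<alpha> \<beta>)"

definition M2 :: "'k \<Rightarrow> 'k \<Rightarrow> (qgen word \<Rightarrow>\<^sub>0 'k::field) set ring"
  where "M2 \<alpha> \<beta> = ring_of_type_algebra Quot M2_ideal \<alpha> \<beta>"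

definition M2_scalar :: "'k \<Rightarrow> 'k \<Rightarrow> 'k \<Rightarrow> (qgen word \<Rightarrow>\<^sub>0 'k::field) set"
  where "M2_scalar \<alpha> \<beta> c = M2_ideal \<alpha> \<beta> +>\<^bsub>ring_of_type_algebra\<^esub> fscale c 1"

definition unit_ord :: "'k::field \<Rightarrow> nat"
  where "unit_ord \<xi> = group.ord (mult_of ring_of_type_algebra) \<xi>"

definition root_of_unity :: "'k::field \<Rightarrow> bool"
  where "root_of_unity \<xi> \<longleftrightarrow> (\<exists>n>0. \<xi> ^ n = 1)"

definition basis_e :: "nat \<Rightarrow> nat \<Rightarrow> (nat \<times> nat \<Rightarrow>\<^sub>0 'k::field)"
  where "basis_e a b = Poly_Mapping.single (a, b) 1"

definition V3 :: "'k \<Rightarrow> 'k \<Rightarrow> (nat \<times> nat \<Rightarrow>\<^sub>0 'k::field) set"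
  where "V3 \<alpha> \<beta> =
    {v. Poly_Mapping.keys v \<subseteq> {..<unit_ord (\<alpha> * \<beta>)} \<times> {..<unit_ord (\<alpha> * inverse \<beta>)}}"

definition add_mod :: "nat \<Rightarrow> nat \<Rightarrow> int \<Rightarrow> nat"
  where "add_mod l b s = nat ((int b + s) mod int l)"

fun V3_gen_basis ::
  "'k \<Rightarrow> 'k \<Rightarrow> 'k \<Rightarrow> 'k \<Rightarrow> qgen \<Rightarrow> nat \<times> nat \<Rightarrow> (nat \<times> nat \<Rightarrow>\<^sub>0 'k::field)"
where
  "V3_gen_basis \<alpha> \<beta> \<mu>1 \<mu>2 X11 (a, b) =
     (if a \<noteq> 0
      then fscale (\<mu>2 * inverse \<alpha> * (inverse \<alpha> * \<beta>) ^ b * ((\<alpha> * \<beta>) ^ a - 1)) (basis_e (a - 1) b)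
      else 0)"
| "V3_gen_basis \<alpha> \<beta> \<mu>1 \<mu>2 X12 (a, b) =
     fscale (inverse \<mu>1 * \<mu>2 * \<beta> ^ a * (inverse \<alpha> * \<beta>) ^ b)
       (basis_e a (add_mod (unit_ord (\<alpha> * inverse \<beta>)) b (-1)))"
| "V3_gen_basis \<alpha> \<beta> \<mu>1 \<mu>2 X21 (a, b) =
     fscale (\<mu>1 * \<alpha> ^ a) (basis_e a (add_mod (unit_ord (\<alpha> * inverse \<beta>)) b 1))"
| "V3_gen_basis \<alpha> \<beta> \<mu>1 \<mu>2 X22 (a, b) =
     (if a \<noteq> unit_ord (\<alpha> * \<beta>) - 1 then basis_e (a + 1) b else 0)"

definition V3_gen_act ::
  "'k \<Rightarrow> 'k \<Rightarrow> 'k \<Rightarrow> 'k \<Rightarrow> (nat \<times> nat \<Rightarrow>\<^sub>0 'k::field) \<Rightarrow> qgen \<Rightarrow> (nat \<times> nat \<Rightarrow>\<^sub>0 'k)"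
  where "V3_gen_act \<alpha> \<beta> \<mu>1 \<mu>2 v x = lin_ext (V3_gen_basis \<alpha> \<beta> \<mu>1 \<mu>2 x) v"

text \<open>
  A word \<open>x\<^sub>1 x\<^sub>2 \<dots> x\<^sub>n\<close> acts on the right, so \<open>x\<^sub>1\<close> is applied first.
\<close>

definition V3_free_act ::
  "'k \<Rightarrow> 'k \<Rightarrow> 'k \<Rightarrow> 'k \<Rightarrow> (nat \<times> nat \<Rightarrow>\<^sub>0 'k::field) \<Rightarrow> (qgen word \<Rightarrow>\<^sub>0 'k) \<Rightarrow> (nat \<times> nat \<Rightarrow>\<^sub>0 'k)"
  where "V3_free_act \<alpha> \<beta> \<mu>1 \<mu>2 v p =
    lin_ext (\<lambda>w. foldl (V3_gen_act \<alpha> \<beta> \<mu>1 \<mu>2) v (letters w)) p"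

text \<open>
  The induced action of a coset: the common value of the action of its representatives.
\<close>

definition V3_act ::
  "'k \<Rightarrow> 'k \<Rightarrow> 'k \<Rightarrow> 'k \<Rightarrow> (nat \<times> nat \<Rightarrow>\<^sub>0 'k::field) \<Rightarrow> (qgen word \<Rightarrow>\<^sub>0 'k) set \<Rightarrow>
    (nat \<times> nat \<Rightarrow>\<^sub>0 'k)"
  where "V3_act \<alpha> \<beta> \<mu>1 \<mu>2 v C = the_elem (V3_free_act \<alpha> \<beta> \<mu>1 \<mu>2 v ` C)"

end

theory Submission
  imports Defs
begin

text \<open>
  On the basis vectors \<open>e(a,b)\<close> the operators \<open>X\<^sub>1\<^sub>2 X\<^sub>2\<^sub>1\<close> and \<open>X\<^sub>1\<^sub>1 X\<^sub>2\<^sub>2\<close> are diagonal, with eigenvalues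
  \<open>\<mu>\<^sub>2 \<gamma>\<^sup>b q\<^sup>a\<close> and \<open>\<mu>\<^sub>2 \<alpha>\<inverse> \<gamma>\<^sup>b (q\<^sup>a - 1)\<close>, where \<open>q = \<alpha>\<beta>\<close> and \<open>\<gamma> = \<alpha>\<inverse>\<beta>\<close>.  The two eigenvalues
  together determine \<open>\<gamma>\<^sup>b\<close> and \<open>q\<^sup>a\<close>, hence \<open>(a,b)\<close>, so a nonzero submodule contains some
  \<open>e(a,b)\<close>.  From there \<open>X\<^sub>1\<^sub>1\<close> lowers \<open>a\<close> to \<open>0\<close> because \<open>q\<^sup>a \<noteq> 1\<close> for \<open>0 < a < ord q\<close>,
  \<open>X\<^sub>2\<^sub>1\<close> moves \<open>b\<close> cyclically, and \<open>X\<^sub>2\<^sub>2\<close> raises \<open>a\<close> again.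
\<close>


section \<open>Linear algebra of finitely supported functions\<close>

interpretation fs: vector_space "fscale :: 'k::field \<Rightarrow> ('i \<Rightarrow>\<^sub>0 'k) \<Rightarrow> ('i \<Rightarrow>\<^sub>0 'k)"
  by (rule vector_space_fscale)

lemma fscale_single [simp]: "fscale c (Poly_Mapping.single i d) = Poly_Mapping.single i (c * d)"
  by (intro poly_mapping_eqI) (simp add: lookup_single when_def)

lemma single_eq_single_iff: "Poly_Mapping.single i x = Poly_Mapping.single i y \<longleftrightarrow> x = y"
  by (metis lookup_single_eq)

lemma single_mem_scale:
  assumes "fs.subspace W" "Poly_Mapping.single i k \<in> W" "k \<noteq> 0"
  shows "Poly_Mapping.single i 1 \<in> W"
  using fs.subspace_scale[OF assms(1,2), of "inverse k"] assms(3) by simp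

lemma keys_fscale_subset: "Poly_Mapping.keys (fscale c v) \<subseteq> Poly_Mapping.keys v"
  by (auto simp: in_keys_iff)

lemma poly_mapping_sum_single:
  "(\<Sum>i\<in>Poly_Mapping.keys v. Poly_Mapping.single i (Poly_Mapping.lookup v i)) = v"
  for v :: "'i \<Rightarrow>\<^sub>0 'a::comm_monoid_add"
  by (intro poly_mapping_eqI) (simp add: lookup_sum lookup_single when_def in_keys_iff)

lemma poly_mapping_additive_induct [case_names zero single add]:
  assumes "P 0" "\<And>i c. P (Poly_Mapping.single i c)" "\<And>p q. P p \<Longrightarrow> P q \<Longrightarrow> P (p + q)"
  shows "P (v :: 'i \<Rightarrow>\<^sub>0 'a::comm_monoid_add)"
proof -
  have "P (\<Sum>i\<in>A. Poly_Mapping.single i (Poly_Mapping.lookup v i))" if "finite A" for A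
    using that by induction (auto intro: assms)
  from this[OF finite_keys[of v]] show ?thesis
    by (simp add: poly_mapping_sum_single)
qed

text \<open>Enlarging the index set only adds zero terms; this lets several vectors be summed over
  one common set.\<close>

lemma lin_ext_superset:
  assumes "finite A" "Poly_Mapping.keys v \<subseteq> A"
  shows "lin_ext f v = (\<Sum>i\<in>A. fscale (Poly_Mapping.lookup v i) (f i))"
  unfolding lin_ext_def using assms by (intro sum.mono_neutral_left) (auto simp: in_keys_iff)

lemma lin_ext_add: "lin_ext f (u + v) = lin_ext f u + lin_ext f v"
  using keys_add[of u v]
  by (simp add: lin_ext_superset[of "Poly_Mapping.keys u \<union> Poly_Mapping.keys v"] lookup_add
      fs.scale_left_distrib sum.distrib)

lemma lin_ext_fscale: "lin_ext f (fscale c v) = fscale c (lin_ext f v)"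
  using keys_fscale_subset[of c v]
  by (simp add: lin_ext_superset[of "Poly_Mapping.keys v"] fs.scale_sum_right)

lemma lin_ext_zero [simp]: "lin_ext f 0 = 0"
  by (simp add: lin_ext_def)

lemma lin_ext_single_coeff [simp]: "lin_ext f (Poly_Mapping.single i c) = fscale c (f i)"
  by (simp add: lin_ext_def)

lemma lin_ext_cong:
  "(\<And>i. i \<in> Poly_Mapping.keys v \<Longrightarrow> f i = g i) \<Longrightarrow> lin_ext f v = lin_ext g v"
  by (simp add: lin_ext_def)

lemma lin_ext_diff: "lin_ext f (u - v) = lin_ext f u - lin_ext f v"
  by (metis add_diff_cancel diff_add_cancel lin_ext_add)

lemma lin_ext_comp: "lin_ext f (lin_ext g v) = lin_ext (\<lambda>i. lin_ext f (g i)) v"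
  by (induction v rule: poly_mapping_additive_induct) (auto simp: lin_ext_add lin_ext_fscale)

lemma lin_ext_fscale_fun: "lin_ext (\<lambda>i. fscale c (f i)) v = fscale c (lin_ext f v)"
  by (simp add: lin_ext_def fs.scale_sum_right mult.commute)

lemma lookup_lin_ext_diagonal:
  "Poly_Mapping.lookup (lin_ext (\<lambda>i. Poly_Mapping.single i (d i)) v) i = d i * Poly_Mapping.lookup v i"
  by (simp add: lin_ext_def lookup_sum lookup_single when_def in_keys_iff)

lemma subspace_lin_ext_mem:
  assumes "fs.subspace W" "\<And>i. i \<in> Poly_Mapping.keys v \<Longrightarrow> f i \<in> W"
  shows "lin_ext f v \<in> W"
  unfolding lin_ext_def using assms by (intro fs.subspace_sum fs.subspace_scale) auto

lemma subspace_keys_subset: "fs.subspace {v. Poly_Mapping.keys v \<subseteq> B}"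
  by (auto simp: fs.subspace_def dest!: subsetD[OF keys_add] subsetD[OF keys_fscale_subset])

lemma lin_ext_singles: "lin_ext (\<lambda>i. Poly_Mapping.single i 1) v = v"
  by (simp add: lin_ext_def poly_mapping_sum_single)

lemma span_singles:
  "fs.span ((\<lambda>i. Poly_Mapping.single i 1) ` B) = {v. Poly_Mapping.keys v \<subseteq> B}"
proof (intro equalityI subsetI)
  fix v :: "'a \<Rightarrow>\<^sub>0 'b" assume "v \<in> fs.span ((\<lambda>i. Poly_Mapping.single i 1) ` B)"
  then show "v \<in> {v. Poly_Mapping.keys v \<subseteq> B}"
    by (rule set_mp[OF fs.span_minimal[OF _ subspace_keys_subset], rotated]) auto
next
  fix v :: "'a \<Rightarrow>\<^sub>0 'b" assume "v \<in> {v. Poly_Mapping.keys v \<subseteq> B}"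
  then have "lin_ext (\<lambda>i. Poly_Mapping.single i 1) v \<in> fs.span ((\<lambda>i. Poly_Mapping.single i 1) ` B)"
    by (intro subspace_lin_ext_mem) (auto intro: fs.span_base)
  then show "v \<in> fs.span ((\<lambda>i. Poly_Mapping.single i 1) ` B)"
    by (simp add: lin_ext_singles)
qed

text \<open>By \<open>span_singles\<close>, every vector in the span of the other basis elements has
  a support avoiding \<open>i\<close>.\<close>

lemma independent_singles:
  "fs.independent ((\<lambda>i. Poly_Mapping.single i 1 :: 'i \<Rightarrow>\<^sub>0 'k::field) ` B)"
proof
  assume "fs.dependent ((\<lambda>i. Poly_Mapping.single i 1 :: 'i \<Rightarrow>\<^sub>0 'k) ` B)"
  then obtain i where i: "i \<in> B"
    and span: "Poly_Mapping.single i 1 \<in> fs.span ((\<lambda>i. Poly_Mapping.single i 1 :: 'i \<Rightarrow>\<^sub>0 'k) ` B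
                  - {Poly_Mapping.single i 1})"
    by (auto simp: fs.dependent_def)
  have "(\<lambda>i. Poly_Mapping.single i 1 :: 'i \<Rightarrow>\<^sub>0 'k) ` B - {Poly_Mapping.single i 1}
      \<subseteq> (\<lambda>i. Poly_Mapping.single i 1) ` (B - {i})"
    by auto
  from set_mp[OF fs.span_mono[OF this] span] show False
    by (simp add: span_singles)
qed

lemma dim_keys_subset:
  "fs.dim {v :: 'i \<Rightarrow>\<^sub>0 'k::field. Poly_Mapping.keys v \<subseteq> B} = card B"
proof -
  have "inj_on (\<lambda>i. Poly_Mapping.single i 1 :: 'i \<Rightarrow>\<^sub>0 'k) B"
    by (intro inj_onI) (metis keys_single one_neq_zero singleton_inject)
  then show ?thesis
    using fs.dim_eq_card_independent[OF independent_singles[where B = B and 'k = 'k]]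
    by (simp add: card_image fs.dim_span flip: span_singles)
qed

text \<open>
  In a nonzero vector of minimal support, a diagonal operator separating two support points
  would produce a nonzero vector of smaller support.
\<close>

lemma diagonal_invariant_subspace_single:
  assumes W: "fs.subspace W" "W \<noteq> {0}"
    and sep: "\<And>w i j. \<lbrakk>w \<in> W; i \<in> Poly_Mapping.keys w; j \<in> Poly_Mapping.keys w; i \<noteq> j\<rbrakk> \<Longrightarrow>
      \<exists>d. d i \<noteq> d j \<and> lin_ext (\<lambda>l. Poly_Mapping.single l (d l)) w \<in> W"
  obtains w i where "w \<in> W" "i \<in> Poly_Mapping.keys w" "Poly_Mapping.single i 1 \<in> W"
proof -
  obtain w0 where "w0 \<in> W \<and> w0 \<noteq> 0"
    using W fs.subspace_0 by blast
  then obtain w where w: "w \<in> W" "w \<noteq> 0"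
    and min: "\<And>u. u \<in> W \<Longrightarrow> u \<noteq> 0 \<Longrightarrow> card (Poly_Mapping.keys w) \<le> card (Poly_Mapping.keys u)"
    using ex_has_least_nat[of "\<lambda>w. w \<in> W \<and> w \<noteq> 0" w0 "\<lambda>w. card (Poly_Mapping.keys w)"] by blast
  from w obtain i where i: "i \<in> Poly_Mapping.keys w"
    by (metis all_not_in_conv keys_eq_empty)
  have "j = i" if j: "j \<in> Poly_Mapping.keys w" for j
  proof (rule ccontr)
    assume "j \<noteq> i"
    then obtain d where d: "d i \<noteq> d j" and dW: "lin_ext (\<lambda>l. Poly_Mapping.single l (d l)) w \<in> W"
      using sep w(1) i j by metis
    \<comment> \<open>Subtracting \<open>d j\<close> times \<open>w\<close> cancels the coordinate
      \<open>j\<close>; the coordinate \<open>i\<close> survives because \<open>d i\<close> and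
      \<open>d j\<close> differ.\<close>
    let ?u = "lin_ext (\<lambda>l. Poly_Mapping.single l (d l)) w - fscale (d j) w"
    have lu: "Poly_Mapping.lookup ?u l = (d l - d j) * Poly_Mapping.lookup w l" for l
      by (simp add: lookup_minus lookup_lin_ext_diagonal algebra_simps)
    have "?u \<in> W"
      using dW w(1) W(1) by (intro fs.subspace_diff fs.subspace_scale)
    moreover have "Poly_Mapping.lookup ?u i \<noteq> 0"
      using d i by (simp only: lu) (simp add: in_keys_iff)
    then have "?u \<noteq> 0"
      by auto
    moreover have "Poly_Mapping.keys ?u \<subset> Poly_Mapping.keys w"
    proof -
      have "Poly_Mapping.keys ?u \<subseteq> Poly_Mapping.keys w" "j \<notin> Poly_Mapping.keys ?u"
        by (auto simp only: in_keys_iff lu) auto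
      then show ?thesis using j by blast
    qed
    then have "card (Poly_Mapping.keys ?u) < card (Poly_Mapping.keys w)"
      by (intro psubset_card_mono) auto
    ultimately show False
      using min by fastforce
  qed
  then have keys: "Poly_Mapping.keys w = {i}"
    using i by blast
  have "w = Poly_Mapping.single i (Poly_Mapping.lookup w i)"
    using poly_mapping_sum_single[of w] by (simp add: keys)
  then have "fscale (inverse (Poly_Mapping.lookup w i)) w = Poly_Mapping.single i 1"
    using i by (metis fscale_single in_keys_iff left_inverse)
  moreover have "fscale (inverse (Poly_Mapping.lookup w i)) w \<in> W"
    using w W by (intro fs.subspace_scale)
  ultimately show ?thesis
    using that w(1) i by metis
qed

section \<open>Right modules over algebras given by generators and relations\<close>

lemma ring_ring_of_type_algebra: "ring (ring_of_type_algebra :: 'a::ring_1 ring)"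
proof -
  have "\<exists>y. y + x = 0 \<and> x + y = 0" for x :: 'a
    by (rule exI[of _ "- x"]) simp
  then show ?thesis
    unfolding ring_of_type_algebra_def
    by unfold_locales (auto simp: algebra_simps Units_def)
qed

lemma ring_of_type_algebra_simps:
  "carrier ring_of_type_algebra = UNIV"
  "x \<otimes>\<^bsub>ring_of_type_algebra\<^esub> y = x * y"
  "x \<oplus>\<^bsub>ring_of_type_algebra\<^esub> y = x + y"
  "\<one>\<^bsub>ring_of_type_algebra\<^esub> = 1"
  "\<zero>\<^bsub>ring_of_type_algebra\<^esub> = 0"
  by (simp_all add: ring_of_type_algebra_def)

text \<open>\<open>V3_free_act\<close> with the action of the generators as a parameter, so that the
  passage to the quotient algebra is independent of the formulas for \<open>V3\<close>.\<close>

definition free_act ::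
    "(('i \<Rightarrow>\<^sub>0 'k) \<Rightarrow> 'x \<Rightarrow> ('i \<Rightarrow>\<^sub>0 'k)) \<Rightarrow> ('i \<Rightarrow>\<^sub>0 'k::field) \<Rightarrow> ('x word \<Rightarrow>\<^sub>0 'k) \<Rightarrow> ('i \<Rightarrow>\<^sub>0 'k)"
  where "free_act g v p = lin_ext (\<lambda>w. foldl g v (letters w)) p"

lemma free_act_add_right: "free_act g v (p + q) = free_act g v p + free_act g v q"
  and free_act_diff_right: "free_act g v (p - q) = free_act g v p - free_act g v q"
  and free_act_fscale_right: "free_act g v (fscale c p) = fscale c (free_act g v p)"
  and free_act_zero_right [simp]: "free_act g v 0 = 0"
  by (simp_all add: free_act_def lin_ext_add lin_ext_diff lin_ext_fscale)

lemma free_act_one [simp]: "free_act g v 1 = v"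
  by (simp add: free_act_def zero_word_def flip: single_one)

lemma free_act_gen [simp]: "free_act g v (free_gen x) = g v x"
  by (simp add: free_act_def free_gen_def)

locale free_algebra_action =
  fixes g :: "('i \<Rightarrow>\<^sub>0 'k::field) \<Rightarrow> 'x \<Rightarrow> ('i \<Rightarrow>\<^sub>0 'k)"
  assumes g_add: "g (u + v) x = g u x + g v x"
    and g_fscale: "g (fscale c v) x = fscale c (g v x)"
begin

lemma foldl_add: "foldl g (u + v) xs = foldl g u xs + foldl g v xs"
  by (induction xs arbitrary: u v) (simp_all add: g_add)

lemma foldl_fscale: "foldl g (fscale c v) xs = fscale c (foldl g v xs)"
  by (induction xs arbitrary: v) (simp_all add: g_fscale)

lemma free_act_add_left: "free_act g (u + v) p = free_act g u p + free_act g v p"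
  by (simp add: free_act_def lin_ext_def foldl_add fs.scale_right_distrib sum.distrib)

lemma free_act_fscale_left: "free_act g (fscale c v) p = fscale c (free_act g v p)"
  by (simp add: free_act_def foldl_fscale lin_ext_fscale_fun del: fs.scale_scale)

lemma free_act_zero_left [simp]: "free_act g 0 p = 0"
  using free_act_add_left[of 0 0 p] by simp

lemma free_act_lin_ext:
  "free_act g v p = lin_ext (\<lambda>i. free_act g (Poly_Mapping.single i 1) p) v"
proof (induction v rule: poly_mapping_additive_induct)
  case (single i c)
  then show ?case
    using free_act_fscale_left[of c "Poly_Mapping.single i 1" p] by simp
qed (simp_all add: free_act_add_left lin_ext_add)

text \<open>Both sides are additive in \<open>p\<close> and in \<open>q\<close>, so single words
  with coefficients suffice; there the product is concatenation, and \<open>foldl\<close> over an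
  append lets the first word act first.\<close>

lemma free_act_mult: "free_act g v (p * q) = free_act g (free_act g v p) q"
proof (induction p rule: poly_mapping_additive_induct)
  case (single u c)
  show ?case
  proof (induction q rule: poly_mapping_additive_induct)
    case (single w d)
    then show ?case
      by (simp add: free_act_def mult_single plus_word_def foldl_fscale mult.commute)
  qed (simp_all add: distrib_left free_act_add_right)
qed (simp_all add: distrib_right free_act_add_right free_act_add_left)

end

text \<open>The relations are required to act as zero on \<open>V\<close> only: outside the index
  range of the basis the formulas for \<open>V3\<close> may violate them.\<close>

locale presented_right_module = free_algebra_action g
  for g :: "('i \<Rightarrow>\<^sub>0 'k::field) \<Rightarrow> 'x \<Rightarrow> ('i \<Rightarrow>\<^sub>0 'k)" +
  fixes V :: "('i \<Rightarrow>\<^sub>0 'k) set" and S :: "('x word \<Rightarrow>\<^sub>0 'k) set"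
  assumes subspace: "fs.subspace V"
    and g_closed: "v \<in> V \<Longrightarrow> g v x \<in> V"
    and relations: "\<lbrakk>v \<in> V; p \<in> S\<rbrakk> \<Longrightarrow> free_act g v p = 0"
begin

abbreviation free_algebra :: "('x word \<Rightarrow>\<^sub>0 'k) ring"
  where "free_algebra \<equiv> ring_of_type_algebra"

abbreviation relation_ideal :: "('x word \<Rightarrow>\<^sub>0 'k) set"
  where "relation_ideal \<equiv> genideal free_algebra S"

abbreviation coset :: "('x word \<Rightarrow>\<^sub>0 'k) \<Rightarrow> ('x word \<Rightarrow>\<^sub>0 'k) set"
  where "coset p \<equiv> relation_ideal +>\<^bsub>free_algebra\<^esub> p"

abbreviation coset_act :: "('i \<Rightarrow>\<^sub>0 'k) \<Rightarrow> ('x word \<Rightarrow>\<^sub>0 'k) set \<Rightarrow> ('i \<Rightarrow>\<^sub>0 'k)"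
  where "coset_act v C \<equiv> the_elem (free_act g v ` C)"

lemma foldl_closed: "v \<in> V \<Longrightarrow> foldl g v xs \<in> V"
  by (induction xs arbitrary: v) (auto intro: g_closed)

lemma free_act_closed: "v \<in> V \<Longrightarrow> free_act g v p \<in> V"
  unfolding free_act_def by (intro subspace_lin_ext_mem subspace foldl_closed)

sublocale F: ring free_algebra
  by (rule ring_ring_of_type_algebra)

sublocale I: ideal relation_ideal free_algebra
  by (rule F.genideal_ideal) (simp add: ring_of_type_algebra_simps)

text \<open>The elements annihilating \<open>V\<close> form a two-sided ideal: a right factor acts
  on 0, and a left factor acts first without leaving \<open>V\<close>. It contains \<open>S\<close>,
  hence the ideal generated by \<open>S\<close>.\<close>

lemma relation_ideal_annihilates:
  assumes "p \<in> relation_ideal" "v \<in> V"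
  shows "free_act g v p = 0"
proof -
  let ?J = "{p. \<forall>v\<in>V. free_act g v p = 0}"
  have "ideal ?J free_algebra"
  proof (rule idealI)
    show "ring free_algebra"
      by (rule F.ring_axioms)
    show "subgroup ?J (add_monoid free_algebra)"
    proof (rule F.add.subgroupI)
      fix p assume p: "p \<in> ?J"
      have "\<ominus>\<^bsub>free_algebra\<^esub> p = - p"
        by (rule F.minus_equality) (simp_all add: ring_of_type_algebra_simps)
      then show "\<ominus>\<^bsub>free_algebra\<^esub> p \<in> ?J"
        using p free_act_diff_right[of g _ 0 p] by simp
    qed (auto simp: ring_of_type_algebra_simps free_act_add_right intro!: exI[of _ 0])
  qed (auto simp: ring_of_type_algebra_simps free_act_mult free_act_closed)
  moreover have "S \<subseteq> ?J"
    by (auto simp: relations)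
  ultimately show ?thesis
    using F.genideal_minimal assms by blast
qed

text \<open>Well-definedness of the induced action: representatives differ by elements of the ideal,
  which annihilate \<open>v\<close>, so the image is a singleton and \<open>the_elem\<close> selects
  its element.\<close>

lemma coset_act_coset:
  assumes "v \<in> V"
  shows "coset_act v (coset p) = free_act g v p"
proof -
  have "coset p = (\<lambda>i. i + p) ` relation_ideal"
    by (auto simp: a_r_coset_def' ring_of_type_algebra_simps)
  then have "free_act g v ` coset p = (\<lambda>_. free_act g v p) ` relation_ideal"
    using assms by (simp add: image_image free_act_add_right relation_ideal_annihilates cong: image_cong)
  moreover have "relation_ideal \<noteq> {}"
    using additive_subgroup.zero_closed[OF I.additive_subgroup_axioms] by blast
  ultimately show ?thesis
    by (simp add: image_constant_conv)
qed

lemma carrier_quotient: "carrier (free_algebra Quot relation_ideal) = range coset"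
  by (auto simp: FactRing_def A_RCOSETS_def' ring_of_type_algebra_simps)

lemma coset_mult:
    "coset p \<otimes>\<^bsub>free_algebra Quot relation_ideal\<^esub> coset q = coset (p * q)"
  and coset_add: "coset p \<oplus>\<^bsub>free_algebra Quot relation_ideal\<^esub> coset q = coset (p + q)"
  and coset_one: "\<one>\<^bsub>free_algebra Quot relation_ideal\<^esub> = coset 1"
  using I.rcoset_mult_add[of p q] I.a_rcos_sum[of p q]
  by (simp_all add: FactRing_def ring_of_type_algebra_simps)

text \<open>Every element of the quotient has the form \<open>coset p\<close>, so each module axiom
  reduces to the corresponding rule for \<open>free_act\<close>.\<close>

lemma right_module_quotient:
  "right_module (free_algebra Quot relation_ideal) (\<lambda>c. coset (fscale c 1)) fscale V coset_act"
proof -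
  interpret Q: ring "free_algebra Quot relation_ideal"
    by (rule I.quotient_is_ring)
  \<comment> \<open>Multiplying by a multiple of 1 from either side is scaling; this makes the
    scalars central and multiplicative.\<close>
  have scalar_mult: "fscale c 1 * p = fscale c p" "p * fscale c 1 = fscale c p"
    for c and p :: "'x word \<Rightarrow>\<^sub>0 'k"
    by (induction p rule: poly_mapping_additive_induct)
      (simp_all add: mult_single distrib_left distrib_right fs.scale_right_distrib mult.commute
        flip: single_one)
  show ?thesis
  proof
    show "(\<lambda>c. coset (fscale c 1)) \<in> ring_hom ring_of_type_algebra (free_algebra Quot relation_ideal)"
      by (rule ring_hom_memI)
        (auto simp: carrier_quotient coset_mult coset_add coset_one scalar_mult
          fs.scale_left_distrib ring_of_type_algebra_simps mult.commute simp del: fscale_single)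
  next
    fix c x assume "x \<in> carrier (free_algebra Quot relation_ideal)"
    then show "coset (fscale c 1) \<otimes>\<^bsub>free_algebra Quot relation_ideal\<^esub> x
        = x \<otimes>\<^bsub>free_algebra Quot relation_ideal\<^esub> coset (fscale c 1)"
      by (auto simp: carrier_quotient coset_mult scalar_mult)
  next
    fix v w x assume "v \<in> V" "w \<in> V" "x \<in> carrier (free_algebra Quot relation_ideal)"
    then show "coset_act (v + w) x = coset_act v x + coset_act w x"
      using fs.subspace_add[OF subspace]
      by (auto simp only: carrier_quotient coset_act_coset free_act_add_left)
  qed (auto simp: carrier_quotient coset_mult coset_add coset_one coset_act_coset subspace
      free_act_closed free_act_add_right free_act_mult free_act_fscale_right
      simp del: fscale_single)
qed

text \<open>The coset of \<open>free_gen x\<close> acts as the generator \<open>x\<close> does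
  through \<open>g\<close>, so simplicity can be tested on subspaces invariant under the
  generators.\<close>

lemma simple_right_module_quotient:
  assumes "V \<noteq> {0}"
    and simple: "\<And>W. \<lbrakk>W \<subseteq> V; fs.subspace W; \<And>w x. w \<in> W \<Longrightarrow> g w x \<in> W; W \<noteq> {0}\<rbrakk> \<Longrightarrow> V \<subseteq> W"
  shows "simple_right_module (free_algebra Quot relation_ideal) (\<lambda>c. coset (fscale c 1)) fscale V
    coset_act"
proof -
  interpret right_module "free_algebra Quot relation_ideal" "\<lambda>c. coset (fscale c 1)" fscale V coset_act
    by (rule right_module_quotient)
  show ?thesis
  proof
    fix W assume "submodule W"
    then have W: "W \<subseteq> V" "fs.subspace W"
      and closed: "\<And>w p. w \<in> W \<Longrightarrow> coset_act w (coset p) \<in> W"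
      by (auto simp: submodule_def carrier_quotient)
    have "g w x \<in> W" if "w \<in> W" for w x
      using closed[OF that, of "free_gen x"] that W(1) by (simp add: coset_act_coset subset_iff)
    with simple[OF W] W(1) show "W = {0} \<or> W = V"
      by blast
  qed fact
qed

end

section \<open>Orders of roots of unity\<close>

lemma unit_ord_dvd_iff:
  assumes "\<xi> \<noteq> 0"
  shows "\<xi> ^ n = 1 \<longleftrightarrow> unit_ord \<xi> dvd n"
proof -
  let ?G = "mult_of (ring_of_type_algebra :: 'a ring)"
  interpret F: field "ring_of_type_algebra :: 'a ring"
    by (rule field_from_type_algebra)
  \<comment> \<open>HOL-Algebra has two identical constants \<open>mult_of\<close>; the group lemma is about the other one.\<close>
  interpret G: group ?G
    using F.field_mult_group
    by (simp add: Ring_Divisibility.mult_of_def Multiplicative_Group.mult_of_def)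
  have "\<xi> [^]\<^bsub>?G\<^esub> m = \<xi> ^ m" for m :: nat
    by (induction m) (simp_all add: ring_of_type_algebra_simps)
  then show ?thesis
    using G.pow_eq_id[of \<xi> n] assms by (simp add: unit_ord_def ring_of_type_algebra_simps)
qed

text \<open>The value 0 of \<open>unit_ord\<close> would mean infinite order, against the positive
  exponent; that exponent also rules out the zero element, whose positive powers vanish.\<close>

lemma unit_ord_pos: "root_of_unity \<xi> \<Longrightarrow> 0 < unit_ord \<xi>"
  using unit_ord_dvd_iff[of \<xi>] by (fastforce simp: root_of_unity_def power_0_left)

lemma power_unit_ord: "\<xi> \<noteq> 0 \<Longrightarrow> \<xi> ^ unit_ord \<xi> = 1"
  by (simp add: unit_ord_dvd_iff)

lemma power_eq_1_less_unit_ord: "\<lbrakk>\<xi> \<noteq> 0; n < unit_ord \<xi>; \<xi> ^ n = 1\<rbrakk> \<Longrightarrow> n = 0"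
  by (auto simp: unit_ord_dvd_iff dest: dvd_imp_le)

text \<open>Cancelling the smaller power leaves an exponent strictly between 0 and the
  order.\<close>

lemma inj_on_power_unit_ord:
  assumes "\<xi> \<noteq> 0"
  shows "inj_on (\<lambda>n. \<xi> ^ n) {..<unit_ord \<xi>}"
proof (rule linorder_inj_onI')
  fix m n assume mn: "m \<in> {..<unit_ord \<xi>}" "n \<in> {..<unit_ord \<xi>}" "m < n"
  have "\<xi> ^ m * \<xi> ^ (n - m) = \<xi> ^ n"
    using mn by (simp flip: power_add)
  moreover have "\<xi> ^ (n - m) \<noteq> 1"
    using power_eq_1_less_unit_ord[OF assms, of "n - m"] mn less_imp_diff_less by auto
  ultimately show "\<xi> ^ m \<noteq> \<xi> ^ n"
    using assms by auto
qed

lemma root_of_unity_mult: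
  assumes "root_of_unity \<xi>" "root_of_unity \<eta>"
  shows "root_of_unity (\<xi> * \<eta>)"
proof -
  obtain m n where "0 < m" "0 < n" "\<xi> ^ m = 1" "\<eta> ^ n = 1"
    using assms by (auto simp: root_of_unity_def)
  then have "\<xi> ^ (m * n) = 1" "\<eta> ^ (n * m) = 1" "0 < m * n"
    by (simp_all add: power_mult)
  then show ?thesis
    unfolding root_of_unity_def by (metis mult.commute mult_1 power_mult_distrib)
qed

lemma root_of_unity_inverse: "root_of_unity \<xi> \<Longrightarrow> root_of_unity (inverse \<xi>)"
  by (auto simp: root_of_unity_def power_inverse)

section \<open>Cyclic shifts modulo \<open>l\<close>\<close>

lemma add_mod_less: "0 < l \<Longrightarrow> add_mod l b s < l"
  by (simp add: add_mod_def nat_less_iff)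

lemma add_mod_add_mod: "0 < l \<Longrightarrow> add_mod l (add_mod l b s) t = add_mod l b (s + t)"
  by (simp add: add_mod_def mod_add_left_eq add.assoc)

lemma add_mod_0: "b < l \<Longrightarrow> add_mod l b 0 = b"
  by (simp add: add_mod_def)

text \<open>Exponents of \<open>c\<close> matter only modulo \<open>l\<close>, so the reduction in
  \<open>add_mod\<close> is invisible; \<open>powi\<close> covers negative shifts.\<close>

lemma power_add_mod:
  fixes c :: "'k::field"
  assumes "0 < l" "c \<noteq> 0" "c ^ l = 1"
  shows "c ^ add_mod l b s = c ^ b * c powi s"
proof -
  define k where "k = int b + s"
  have "c powi k = c powi (int l * (k div int l) + k mod int l)"
    by simp
  also have "\<dots> = (c powi int l) powi (k div int l) * c powi (k mod int l)"
    using assms(2) by (subst power_int_add) (simp_all add: power_int_mult)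
  also have "\<dots> = c powi (k mod int l)"
    using assms(3) by simp
  also have "\<dots> = c ^ add_mod l b s"
    using assms(1) by (simp add: power_int_def add_mod_def k_def)
  finally show ?thesis
    using assms(2) by (simp add: k_def power_int_add)
qed

section \<open>The module \<open>V3\<close> and its defining relations\<close>

locale V3_module =
  fixes \<alpha> \<beta> \<mu>1 \<mu>2 :: "'k::field"
  assumes \<alpha>: "\<alpha> \<noteq> 0" "root_of_unity \<alpha>" and \<beta>: "\<beta> \<noteq> 0" "root_of_unity \<beta>"
    and \<mu>: "\<mu>1 \<noteq> 0" "\<mu>2 \<noteq> 0"
begin

definition "q = \<alpha> * \<beta>"
definition "\<gamma> = inverse \<alpha> * \<beta>"
definition "l1 = unit_ord (\<alpha> * \<beta>)"
definition "l2 = unit_ord (\<alpha> * inverse \<beta>)"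
abbreviation "act \<equiv> V3_gen_act \<alpha> \<beta> \<mu>1 \<mu>2"
abbreviation "V \<equiv> V3 \<alpha> \<beta>"

lemma \<gamma>_nonzero: "\<gamma> \<noteq> 0"
  using \<alpha> \<beta> by (simp add: \<gamma>_def)

text \<open>The range of \<open>b\<close> is the order of \<open>\<alpha> * inverse \<beta>\<close>,
  while the action involves powers of its inverse; facts about that order are transferred by
  inversion.\<close>

lemma \<gamma>_eq: "\<gamma> = inverse (\<alpha> * inverse \<beta>)"
  by (simp add: \<gamma>_def)

lemma l1_pos: "0 < l1" and l2_pos: "0 < l2"
  using \<alpha> \<beta>
  by (simp_all add: l1_def l2_def unit_ord_pos root_of_unity_mult root_of_unity_inverse)

lemma power_l1: "q ^ l1 = 1"
  using \<alpha> \<beta> by (simp add: power_unit_ord q_def l1_def)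

lemma power_l2: "\<gamma> ^ l2 = 1"
  using power_unit_ord[of "\<alpha> * inverse \<beta>"] \<alpha> \<beta> by (simp only: l2_def \<gamma>_eq power_inverse) simp

text \<open>The shifts multiply by \<open>\<gamma>\<close> and its inverse, spelled out in
  \<open>\<alpha>\<close> and \<open>\<beta>\<close> to match the scalars of the relations.\<close>

lemma power_shift:
  "\<gamma> ^ add_mod l2 b 1 = \<gamma> ^ b * (inverse \<alpha> * \<beta>)"
  "\<gamma> ^ add_mod l2 b (-1) = \<gamma> ^ b * (\<alpha> * inverse \<beta>)"
  by (simp_all add: power_add_mod[OF l2_pos \<gamma>_nonzero power_l2] power_int_minus)
    (simp_all add: \<gamma>_def)

lemma q_power_inj: "\<lbrakk>q ^ a = q ^ a'; a < l1; a' < l1\<rbrakk> \<Longrightarrow> a = a'"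
  using inj_on_power_unit_ord[of "\<alpha> * \<beta>"] \<alpha> \<beta> by (auto simp: inj_on_def q_def l1_def)

lemma \<gamma>_power_inj:
  assumes "\<gamma> ^ b = \<gamma> ^ b'" "b < l2" "b' < l2"
  shows "b = b'"
proof -
  have "(\<alpha> * inverse \<beta>) ^ b = (\<alpha> * inverse \<beta>) ^ b'"
    using assms(1) by (simp only: \<gamma>_eq power_inverse inverse_eq_iff_eq)
  then show ?thesis
    using inj_on_power_unit_ord[of "\<alpha> * inverse \<beta>"] assms \<alpha> \<beta> by (auto simp: inj_on_def l2_def)
qed

sublocale free_algebra_action act
  by unfold_locales (simp_all add: V3_gen_act_def lin_ext_add lin_ext_fscale)

lemma act_zero [simp]: "act 0 x = 0"
  by (simp add: V3_gen_act_def)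

text \<open>For \<open>a = 0\<close> the factor \<open>q ^ a - 1\<close> vanishes, so the formula
  for \<open>X11\<close> needs no case distinction and the truncated value of \<open>a - 1\<close>
  is harmless.\<close>

lemma act_single:
  "act (Poly_Mapping.single (a, b) k) X11 =
     Poly_Mapping.single (a - 1, b) (k * (\<mu>2 * inverse \<alpha> * \<gamma> ^ b * (q ^ a - 1)))"
  "act (Poly_Mapping.single (a, b) k) X12 =
     Poly_Mapping.single (a, add_mod l2 b (-1)) (k * (inverse \<mu>1 * \<mu>2 * \<beta> ^ a * \<gamma> ^ b))"
  "act (Poly_Mapping.single (a, b) k) X21 =
     Poly_Mapping.single (a, add_mod l2 b 1) (k * (\<mu>1 * \<alpha> ^ a))"
  "act (Poly_Mapping.single (a, b) k) X22 =
     (if a \<noteq> l1 - 1 then Poly_Mapping.single (a + 1, b) k else 0)"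
  by (simp_all add: V3_gen_act_def basis_e_def l1_def l2_def \<gamma>_def q_def)

text \<open>All four products enter the last two relations; \<open>X12 X21\<close> and
  \<open>X11 X22\<close> also serve to separate the basis vectors.\<close>

lemma act_single_diagonal:
  assumes "a < l1" "b < l2"
  shows "act (act (Poly_Mapping.single (a, b) k) X12) X21 =
      Poly_Mapping.single (a, b) (k * (\<mu>2 * \<gamma> ^ b * q ^ a))"
    and "act (act (Poly_Mapping.single (a, b) k) X21) X12 =
      Poly_Mapping.single (a, b) (k * (\<mu>2 * \<gamma> ^ b * (inverse \<alpha> * \<beta>) * q ^ a))"
    and "act (act (Poly_Mapping.single (a, b) k) X11) X22 =
      Poly_Mapping.single (a, b) (k * (\<mu>2 * inverse \<alpha> * \<gamma> ^ b * (q ^ a - 1)))"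
    and "act (act (Poly_Mapping.single (a, b) k) X22) X11 =
      Poly_Mapping.single (a, b)
        (k * (\<mu>2 * inverse \<alpha> * \<gamma> ^ b * (q ^ (a + 1) - 1)))"
proof -
  \<comment> \<open>In the top row \<open>X22\<close> gives 0, which agrees with the general formula
    because \<open>q ^ l1 = 1\<close>.\<close>
  have "a = l1 - 1 \<Longrightarrow> q * q ^ a = 1"
    using l1_pos power_l1 by (metis Suc_pred' power_Suc)
  then show "act (act (Poly_Mapping.single (a, b) k) X22) X11 =
      Poly_Mapping.single (a, b)
        (k * (\<mu>2 * inverse \<alpha> * \<gamma> ^ b * (q ^ (a + 1) - 1)))"
    by (simp add: act_single)
  show "act (act (Poly_Mapping.single (a, b) k) X11) X22 =
      Poly_Mapping.single (a, b) (k * (\<mu>2 * inverse \<alpha> * \<gamma> ^ b * (q ^ a - 1)))"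
    \<comment> \<open>For \<open>a = 0\<close> both sides vanish; otherwise \<open>X11\<close> leads
      to a row below \<open>l1 - 1\<close>, from which \<open>X22\<close> climbs back.\<close>
    using assms by (cases a) (auto simp: act_single)
qed (use assms l2_pos \<mu> in
  \<open>simp_all add: act_single add_mod_add_mod add_mod_0 power_shift q_def power_mult_distrib field_simps\<close>)

text \<open>The last two relations compare diagonal operators. In the others one generator changes
  \<open>a\<close> and the other \<open>b\<close>, and the scalar of the relation arises from the
  effect of these changes on the powers in the coefficients.\<close>

lemma relations_single:
  assumes "p \<in> M2_relations \<alpha> \<beta>" "a < l1" "b < l2"
  shows "free_act act (Poly_Mapping.single (a, b) 1) p = 0"
proof -
  note [simp] = free_act_diff_right free_act_fscale_right free_act_mult
  consider "p = free_gen X12 * free_gen X11 - fscale \<alpha> (free_gen X11 * free_gen X12)"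
    | "p = free_gen X22 * free_gen X21 - fscale \<alpha> (free_gen X21 * free_gen X22)"
    | "p = free_gen X21 * free_gen X11 - fscale \<beta> (free_gen X11 * free_gen X21)"
    | "p = free_gen X22 * free_gen X12 - fscale \<beta> (free_gen X12 * free_gen X22)"
    | "p = free_gen X21 * free_gen X12 - fscale (\<beta> * inverse \<alpha>) (free_gen X12 * free_gen X21)"
    | "p = free_gen X22 * free_gen X11 - free_gen X11 * free_gen X22
        - fscale (\<beta> - inverse \<alpha>) (free_gen X12 * free_gen X21)"
    using assms(1) by (auto simp: M2_relations_def Let_def)
  then show ?thesis
  proof cases
    case 1
    show ?thesis
      \<comment> \<open>For \<open>a = 0\<close> both products vanish; otherwise
        \<open>a - 1\<close> is a genuine predecessor in the exponent of
        \<open>\<beta>\<close>.\<close>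
      unfolding 1 using \<alpha> \<beta> \<mu> by (cases a) (simp_all add: act_single power_shift single_eq_single_iff field_simps)
  next
    case 2
    then show ?thesis
      by (simp add: act_single mult_ac)
  next
    case 3
    show ?thesis
      unfolding 3 using \<alpha> \<beta> \<mu> by (cases a) (simp_all add: act_single power_shift single_eq_single_iff field_simps)
  next
    case 4
    then show ?thesis
      by (simp add: act_single mult_ac)
  next
    case 5
    then show ?thesis
      using assms by (simp add: act_single_diagonal mult_ac)
  next
    case 6
    \<comment> \<open>The difference of the powers is \<open>(q - 1) * q ^ a\<close>, and
      \<open>inverse \<alpha> * (q - 1) = \<beta> - inverse \<alpha>\<close>.\<close>
    have "\<mu>2 * inverse \<alpha> * \<gamma> ^ b * (q ^ (a + 1) - 1)
        - \<mu>2 * inverse \<alpha> * \<gamma> ^ b * (q ^ a - 1)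
      = (\<beta> - inverse \<alpha>) * (\<mu>2 * \<gamma> ^ b * q ^ a)"
      using \<alpha> by (simp add: q_def field_simps)
    with 6 show ?thesis
      using assms by (simp add: act_single_diagonal flip: single_diff)
  qed
qed

lemma act_lin_ext: "act v x = lin_ext (\<lambda>i. act (Poly_Mapping.single i 1) x) v"
  by (simp add: V3_gen_act_def)

lemma act_act_lin_ext:
  "act (act v x) y = lin_ext (\<lambda>i. act (act (Poly_Mapping.single i 1) x) y) v"
  by (simp add: V3_gen_act_def lin_ext_comp)

lemma subspace_V: "fs.subspace V"
  unfolding V3_def by (rule subspace_keys_subset)

lemma single_mem_V: "\<lbrakk>a < l1; b < l2\<rbrakk> \<Longrightarrow> Poly_Mapping.single (a, b) k \<in> V"
  by (auto simp: V3_def l1_def l2_def)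

lemma V_keys: "\<lbrakk>v \<in> V; (a, b) \<in> Poly_Mapping.keys v\<rbrakk> \<Longrightarrow> a < l1 \<and> b < l2"
  by (auto simp: V3_def l1_def l2_def)

sublocale presented_right_module act V "M2_relations \<alpha> \<beta>"
proof
  show "fs.subspace V"
    by (rule subspace_V)
  show "act v x \<in> V" if "v \<in> V" for v x
  proof (subst act_lin_ext, rule subspace_lin_ext_mem[OF subspace_V])
    fix i assume "i \<in> Poly_Mapping.keys v"
    then obtain a b where "i = (a, b)" "a < l1" "b < l2"
      using V_keys[of v] \<open>v \<in> V\<close> by (cases i) blast
    then show "act (Poly_Mapping.single i 1) x \<in> V"
      using l2_pos
      by (cases x) (auto simp: act_single intro!: single_mem_V add_mod_less fs.subspace_0[OF subspace_V])
  qed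
  show "free_act act v p = 0" if "v \<in> V" "p \<in> M2_relations \<alpha> \<beta>" for v p
    unfolding free_act_lin_ext[of v] using that V_keys[of v] relations_single
    by (fastforce simp: lin_ext_def intro!: sum.neutral)
qed

section \<open>Simplicity: subspaces invariant under the generators\<close>

lemma invariant_subspace_eq_V:
  assumes W: "W \<subseteq> V" "fs.subspace W" "W \<noteq> {0}"
    and act_W: "\<And>w x. w \<in> W \<Longrightarrow> act w x \<in> W"
  shows "V \<subseteq> W"
proof -
  have sep: "\<exists>d. d i \<noteq> d j \<and> lin_ext (\<lambda>l. Poly_Mapping.single l (d l)) w \<in> W"
    if w: "w \<in> W" and ij: "i \<in> Poly_Mapping.keys w" "j \<in> Poly_Mapping.keys w" "i \<noteq> j" for w i j
  proof -
    let ?d = "\<lambda>(a, b). \<mu>2 * \<gamma> ^ b * q ^ a"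
    let ?d' = "\<lambda>(a, b). \<mu>2 * inverse \<alpha> * \<gamma> ^ b * (q ^ a - 1)"
    have "lin_ext (\<lambda>l. Poly_Mapping.single l (?d l)) w = act (act w X12) X21"
      "lin_ext (\<lambda>l. Poly_Mapping.single l (?d' l)) w = act (act w X11) X22"
      \<comment> \<open>The diagonal formulas are available inside the index rectangle, which
        contains the support of \<open>w\<close> since \<open>W\<close> lies in
        \<open>V\<close>.\<close>
      unfolding act_act_lin_ext[of w] using V_keys w W(1)
      by (auto intro!: lin_ext_cong simp: act_single_diagonal split: prod.splits)
    then have mem: "lin_ext (\<lambda>l. Poly_Mapping.single l (?d l)) w \<in> W"
      "lin_ext (\<lambda>l. Poly_Mapping.single l (?d' l)) w \<in> W"
      using act_W w by simp_all
    have "i = j" if "?d i = ?d j" "?d' i = ?d' j"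
    proof -
      obtain a b a' b' where eq: "i = (a, b)" "j = (a', b')"
        by fastforce
      have bounds: "a < l1" "b < l2" "a' < l1" "b' < l2"
        using V_keys w W(1) ij eq by blast+
      have "\<gamma> ^ b * q ^ a = \<gamma> ^ b' * q ^ a'"
        "\<gamma> ^ b * (q ^ a - 1) = \<gamma> ^ b' * (q ^ a' - 1)"
        using that \<alpha> \<mu> by (auto simp: eq mult.assoc)
      \<comment> \<open>Subtracting the second equation from the first isolates this power.\<close>
      then have b: "\<gamma> ^ b = \<gamma> ^ b'"
        by (simp add: right_diff_distrib)
      with \<open>\<gamma> ^ b * q ^ a = \<gamma> ^ b' * q ^ a'\<close>
      have "q ^ a = q ^ a'"
        using \<gamma>_nonzero by simp
      with b show "i = j"
        using q_power_inj \<gamma>_power_inj bounds eq by blast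
    qed
    with mem ij(3) show ?thesis
      by blast
  qed
  obtain w i where "w \<in> W" "i \<in> Poly_Mapping.keys w" "Poly_Mapping.single i 1 \<in> W"
    using diagonal_invariant_subspace_single[OF W(2,3) sep] by blast
  then obtain a0 b0 where ab: "Poly_Mapping.single (a0, b0) 1 \<in> W" "a0 < l1" "b0 < l2"
    using V_keys W(1) by (metis subsetD surj_pair)
  have "Poly_Mapping.single (0, b0) 1 \<in> W"
    using ab(1,2)
  proof (induction a0)
    case (Suc a)
    \<comment> \<open>\<open>Suc a\<close> is below the order of \<open>q\<close>, so the
      coefficient of the image under \<open>X11\<close> is nonzero and can be divided out.\<close>
    have "q ^ Suc a \<noteq> 1"
      using q_power_inj[of "Suc a" 0] Suc.prems l1_pos by auto
    then have "Poly_Mapping.single (a, b0) 1 \<in> W"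
      using \<alpha> \<mu> \<gamma>_nonzero
      by (intro single_mem_scale[OF W(2) act_W[OF Suc.prems(1), of X11, unfolded act_single diff_Suc_1]])
        auto
    with Suc show ?case
      by simp
  qed
  then have shift: "Poly_Mapping.single (0, add_mod l2 b0 (int n)) 1 \<in> W" for n
  proof (induction n)
    case 0
    then show ?case
      using ab by (simp add: add_mod_0)
  next
    case (Suc n)
    then show ?case
      using act_W[OF Suc.IH, of X21] \<mu> l2_pos
      \<comment> \<open>In the row \<open>a = 0\<close> the factor \<open>\<alpha> ^ a\<close> is 1,
        so \<open>X21\<close> scales by \<open>\<mu>1\<close> alone.\<close>
      by (intro single_mem_scale[OF W(2), of _ \<mu>1])
        (auto simp: act_single add_mod_add_mod add.commute)
  qed
  have row: "Poly_Mapping.single (0, b) 1 \<in> W" if "b < l2" for b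
  proof -
    \<comment> \<open>The number of shifts leading from \<open>b0\<close> to \<open>b\<close>;
      adding \<open>l2\<close> keeps the natural subtraction exact.\<close>
    have "add_mod l2 b0 (int (b + l2 - b0)) = b"
      using that ab(3) by (simp add: add_mod_def of_nat_diff)
    with shift show ?thesis
      by metis
  qed
  have "Poly_Mapping.single (a, b) 1 \<in> W" if "a < l1" "b < l2" for a b
    using that(1)
  proof (induction a)
    \<comment> \<open>The bound \<open>Suc a < l1\<close> excludes the top row, which
      \<open>X22\<close> sends to 0.\<close>
    case (Suc a)
    then show ?case
      using act_W[of "Poly_Mapping.single (a, b) 1" X22] by (auto simp: act_single split: if_splits)
  qed (use row that in simp)
  then have "lin_ext (\<lambda>i. Poly_Mapping.single i 1) v \<in> W" if "v \<in> V" for v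
    using that V_keys by (intro subspace_lin_ext_mem[OF W(2)]) auto
  then show ?thesis
    by (auto simp: lin_ext_singles)
qed

end

theorem theorem5p3:
  fixes \<alpha> \<beta> \<mu>1 \<mu>2 :: "'k::alg_closed_field"
  assumes "\<alpha> \<noteq> 0" and "\<beta> \<noteq> 0"
    and "root_of_unity \<alpha>" and "root_of_unity \<beta>"
    and "\<alpha> * \<beta> \<noteq> 1"
    and "\<mu>1 \<noteq> 0" and "\<mu>2 \<noteq> 0"
  shows "simple_right_module (M2 \<alpha> \<beta>) (M2_scalar \<alpha> \<beta>) fscale
           (V3 \<alpha> \<beta>) (V3_act \<alpha> \<beta> \<mu>1 \<mu>2)
       \<and> vector_space.dim fscale (V3 \<alpha> \<beta>) = unit_ord (\<alpha> * \<beta>) * unit_ord (\<alpha> * inverse \<beta>)"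
proof
  interpret V3_module \<alpha> \<beta> \<mu>1 \<mu>2
    by unfold_locales (use assms in auto)
  have "V \<noteq> {0}"
    using single_mem_V[OF l1_pos l2_pos, of 1]
    by (metis lookup_single_eq lookup_zero one_neq_zero singletonD)
  then have "simple_right_module (free_algebra Quot relation_ideal) (\<lambda>c. coset (fscale c 1)) fscale V
      coset_act"
    by (rule simple_right_module_quotient) (rule invariant_subspace_eq_V)
  \<comment> \<open>The concrete definitions are the generic ones, with \<open>act\<close> as the
    action of the generators and \<open>M2_relations\<close> as \<open>S\<close>.\<close>
  moreover have "M2_scalar \<alpha> \<beta> = (\<lambda>c. coset (fscale c 1))" "V3_act \<alpha> \<beta> \<mu>1 \<mu>2 = coset_act"
    by (simp_all add: fun_eq_iff M2_scalar_def M2_ideal_def V3_act_def V3_free_act_def free_act_def)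
  ultimately show "simple_right_module (M2 \<alpha> \<beta>) (M2_scalar \<alpha> \<beta>) fscale (V3 \<alpha> \<beta>) (V3_act \<alpha> \<beta> \<mu>1 \<mu>2)"
    by (simp add: M2_def M2_ideal_def)
  show "vector_space.dim fscale (V3 \<alpha> \<beta>) = unit_ord (\<alpha> * \<beta>) * unit_ord (\<alpha> * inverse \<beta>)"
    by (simp add: V3_def dim_keys_subset)
qed

end
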